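(* Assume $n\ge2$, fix $\lambda\ge0$ and let $(p^t)_{t\ge0}$ be the iterates of the Blahut–Arimoto iteration started from the uniform distribution. Then for every $t\ge1$, $$0\le F(\lambda)-f_\lambda(p^{t+1},p^t)<\frac{\ln n}{t}.$$ Hence an accuracy $\varepsilon>0$ for $F(\lambda)$ is reached after at most $(\ln n)/\varepsilon$ iterations.
   Context: Setup: integers $n\ge 2$, $m\ge1$; density matrices $\rho_1,\dots,\rho_n\in\mathcal{D}^m$ ($m\times m$ complex positive semidefinite, trace one); $\Delta_n$ the probability simplex in $\mathbb{R}^n$; $s\in\mathbb{R}^n$, $s\ge0$; $\lambda\ge0$. All logarithms are natural; matrix logarithms of positive semidefinite matrices are taken on their support, convention $0\ln0=0$. For $p\in\Delta_n$, $\rho_p=\sum_xp_x\rho_x$. For $p,p'\in\Delta_n$, $$f_\lambda(p,p')=\sum_x p_x\ln\frac{p'_x}{p_x}+\sum_x p_x\operatorname{Tr}[\rho_x(\ln\rho_x-\ln\rho_{p'})]-\lambda s^Tp$$ (terms with $p_x=0$ are zero; value $-\infty$ if $p_x>0=p'_x$ for some $x$), and $F(\lambda)=\max_{p}\max_{p'}f_\lambda(p,p')$. Blahut–Arimoto iteration: $p^0_x=1/n$ for all $x$; given $p^t$ with positive entries, set $\rho^t=\rho_{p^t}$, $r^t_x=\exp\big(\ln p^t_x+\operatorname{Tr}[\rho_x\ln\rho_x]-\operatorname{Tr}[\rho_x\ln\rho^t]-\lambda s_x\big)$ and $p^{t+1}_x=r^t_x/\sum_yr^t_y$. *)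

theory Defs
  imports "HOL-Analysis.Analysis"
begin

definition adjoint_mat :: "complex^'m^'m \<Rightarrow> complex^'m^'m" where
  "adjoint_mat A = (\<chi> i j. cnj (A $ j $ i))"

definition hermitian_mat :: "complex^'m^'m \<Rightarrow> bool" where
  "hermitian_mat A \<longleftrightarrow> adjoint_mat A = A"

definition psd_mat :: "complex^'m^'m \<Rightarrow> bool" where
  "psd_mat A \<longleftrightarrow> hermitian_mat A \<and>
     (\<forall>v :: complex^'m. 0 \<le> Re (\<Sum>i\<in>UNIV. \<Sum>j\<in>UNIV. cnj (v $ i) * A $ i $ j * v $ j))"

definition density_mat :: "complex^'m^'m \<Rightarrow> bool" where
  "density_mat A \<longleftrightarrow> psd_mat A \<and> trace A = 1"

definition unitary_mat :: "complex^'m^'m \<Rightarrow> bool" where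
  "unitary_mat U \<longleftrightarrow> adjoint_mat U ** U = mat 1"

definition diag_mat :: "('m \<Rightarrow> complex) \<Rightarrow> complex^'m^'m" where
  "diag_mat d = (\<chi> i j. if i = j then d i else 0)"

text \<open>Matrix logarithm of a positive semidefinite matrix, taken on its support:
  if A = U diag(d) U^* (spectral decomposition) then
  ln A = U diag(ln d_i for d_i > 0, 0 otherwise) U^*.  (Independent of the decomposition.)\<close>
definition mat_ln :: "complex^'m^'m \<Rightarrow> complex^'m^'m" where
  "mat_ln A = (SOME L. \<exists>U d. unitary_mat U \<and>
      A = U ** diag_mat (\<lambda>i. complex_of_real (d i)) ** adjoint_mat U \<and>
      L = U ** diag_mat (\<lambda>i. complex_of_real (if d i > 0 then ln (d i) else 0)) ** adjoint_mat U)"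

definition prob_simplex :: "('n::finite \<Rightarrow> real) set" where
  "prob_simplex = {p. (\<forall>x. 0 \<le> p x) \<and> (\<Sum>x\<in>UNIV. p x) = 1}"

definition mix :: "('n::finite \<Rightarrow> complex^'m^'m) \<Rightarrow> ('n \<Rightarrow> real) \<Rightarrow> complex^'m^'m" where
  "mix \<rho> p = (\<Sum>x\<in>UNIV. p x *\<^sub>R \<rho> x)"

definition fobj :: "('n::finite \<Rightarrow> complex^'m^'m) \<Rightarrow> ('n \<Rightarrow> real) \<Rightarrow> real
    \<Rightarrow> ('n \<Rightarrow> real) \<Rightarrow> ('n \<Rightarrow> real) \<Rightarrow> ereal" where
  "fobj \<rho> s lam p p' =
     (if \<exists>x. p x > 0 \<and> p' x = 0 then -\<infinity>
      else ereal ((\<Sum>x\<in>UNIV. if p x = 0 then 0 else p x * ln (p' x / p x))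
                + (\<Sum>x\<in>UNIV. if p x = 0 then 0 else
                     p x * Re (trace (\<rho> x ** (mat_ln (\<rho> x) - mat_ln (mix \<rho> p')))))
                - lam * (\<Sum>x\<in>UNIV. s x * p x)))"

definition Fopt :: "('n::finite \<Rightarrow> complex^'m^'m) \<Rightarrow> ('n \<Rightarrow> real) \<Rightarrow> real \<Rightarrow> ereal" where
  "Fopt \<rho> s lam = (SUP p\<in>prob_simplex. SUP p'\<in>prob_simplex. fobj \<rho> s lam p p')"

primrec BA :: "('n::finite \<Rightarrow> complex^'m^'m) \<Rightarrow> ('n \<Rightarrow> real) \<Rightarrow> real \<Rightarrow> nat \<Rightarrow> ('n \<Rightarrow> real)" where
  "BA \<rho> s lam 0 = (\<lambda>x. 1 / real CARD('n))"
| "BA \<rho> s lam (Suc t) =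
    (let p = BA \<rho> s lam t;
         r = (\<lambda>x. exp (ln (p x) + Re (trace (\<rho> x ** mat_ln (\<rho> x)))
                        - Re (trace (\<rho> x ** mat_ln (mix \<rho> p))) - lam * s x))
     in (\<lambda>x. r x / (\<Sum>y\<in>UNIV. r y)))"

end

theory Submission
  imports Defs "HOL-Real_Asymp.Real_Asymp"
begin

text \<open>Put \<open>D\<^sub>x(p) = Tr[\<rho>\<^sub>x (ln \<rho>\<^sub>x - ln \<rho>\<^sub>p)] - \<lambda> s\<^sub>x\<close> and let \<open>Z\<^sub>t\<close> be the normalising constant of step \<open>t\<close>, so that
  \<open>f(p\<^sup>t\<^sup>+\<^sup>1, p\<^sup>t) = ln Z\<^sub>t\<close> and \<open>ln (p\<^sup>t\<^sup>+\<^sup>1\<^sub>x / p\<^sup>t\<^sub>x) = D\<^sub>x(p\<^sup>t) - ln Z\<^sub>t\<close>. By Klein's inequality the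
  value \<open>f(p, p)\<close> is at most \<open>\<Sum> p\<^sub>x D\<^sub>x(p\<^sup>t)\<close>, hence \<open>f(p, p) - ln Z\<^sub>t \<le> \<Sum> p\<^sub>x ln (p\<^sup>t\<^sup>+\<^sup>1\<^sub>x / p\<^sup>t\<^sub>x)\<close>, whose sum over
  the first \<open>t + 1\<close> steps telescopes to at most \<open>ln n\<close>. Since \<open>ln Z\<^sub>t\<close> is nondecreasing, the gap at step \<open>t\<close>
  is at most \<open>ln n / (t + 1)\<close>.

  Both the monotonicity of \<open>ln Z\<^sub>t\<close> and \<open>f(p, p') \<le> f(p, p)\<close> rest on the data processing inequality
  \<open>S(\<rho>\<^sub>p \<parallel> \<rho>\<^sub>p\<^sub>') \<le> S(p \<parallel> p')\<close> for relative entropies. It is the integral over \<open>s > 0\<close> of the resolvent inequality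
  \<open>Tr \<rho>\<^sub>p (\<rho>\<^sub>p\<^sub>' + s)\<^sup>-\<^sup>1 \<le> \<Sum> p\<^sub>x Tr \<rho>\<^sub>x (c\<^sub>x \<rho>\<^sub>p + s)\<^sup>-\<^sup>1\<close> with \<open>c\<^sub>x = p'\<^sub>x / p\<^sub>x\<close>.\<close>

subsection \<open>Quadratic forms and spectral decompositions\<close>

definition qform :: "complex^'m^'m \<Rightarrow> complex^'m \<Rightarrow> real" where
  "qform A v = Re (\<Sum>i\<in>UNIV. \<Sum>j\<in>UNIV. cnj (v $ i) * A $ i $ j * v $ j)"

lemma qform_eq_inner: "qform A v = inner v (A *v v)"
  by (simp add: qform_def inner_vec_def matrix_vector_mult_def inner_complex_def sum_distrib_left
      algebra_simps sum.distrib sum_subtractf sum_negf)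

lemma psd_mat_iff_qform: "psd_mat A \<longleftrightarrow> hermitian_mat A \<and> (\<forall>v. 0 \<le> qform A v)"
  by (simp add: psd_mat_def qform_def)

lemma adjoint_mat_nth [simp]: "adjoint_mat A $ i $ j = cnj (A $ j $ i)"
  by (simp add: adjoint_mat_def)

lemma adjoint_mat_adjoint [simp]: "adjoint_mat (adjoint_mat A) = A"
  by (simp add: vec_eq_iff)

lemma adjoint_mat_diff: "adjoint_mat (A - B) = adjoint_mat A - adjoint_mat B"
  by (simp add: vec_eq_iff)

text \<open>The Hermitian product, conjugate-linear in the first argument. \<open>inner\<close> is
  only its real part, too weak to express complex orthogonality.\<close>

definition cprod :: "complex^'m \<Rightarrow> complex^'m \<Rightarrow> complex" where
  "cprod v w = (\<Sum>k\<in>UNIV. cnj (v $ k) * w $ k)"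

lemma Re_cprod: "Re (cprod v w) = inner v w"
  by (simp add: cprod_def inner_vec_def inner_complex_def)

text \<open>Complex orthogonality to \<open>v\<close> becomes real orthogonality to both
  \<open>v\<close> and \<open>\<i> *s v\<close>, so real dimension counts apply to it.\<close>

lemma Im_cprod: "Im (cprod v w) = inner (\<i> *s v) w"
  by (simp add: cprod_def inner_vec_def inner_complex_def sum_subtractf sum.distrib algebra_simps)

lemma cprod_simps:
  "cprod v (w + w') = cprod v w + cprod v w'"
  "cprod v (w - w') = cprod v w - cprod v w'"
  "cprod v (r *\<^sub>R w) = r *\<^sub>R cprod v w"
  by (simp_all add: cprod_def sum.distrib sum_subtractf algebra_simps scaleR_sum_right)

lemma cprod_adjoint: "cprod (A *v v) w = cprod v (adjoint_mat A *v w)"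
proof -
  have "cprod (A *v v) w = (\<Sum>i\<in>UNIV. \<Sum>j\<in>UNIV. cnj (A $ i $ j) * cnj (v $ j) * w $ i)"
    by (simp add: cprod_def matrix_vector_mult_def sum_distrib_right)
  also have "\<dots> = cprod v (adjoint_mat A *v w)"
    by (subst sum.swap) (simp add: cprod_def matrix_vector_mult_def sum_distrib_left algebra_simps)
  finally show ?thesis .
qed

lemma cprod_commute: "cprod v w = cnj (cprod w v)"
  by (simp add: cprod_def mult.commute)

lemma inner_adjoint: "inner (A *v v) w = inner v (adjoint_mat A *v w)"
  using arg_cong[OF cprod_adjoint[of A v w], of Re] by (simp add: Re_cprod)

lemma mat_vec_scaleR: "(A :: complex^'m^'k) *v (c *\<^sub>R v) = c *\<^sub>R (A *v v)"
  by (simp add: vec_eq_iff matrix_vector_mult_def scaleR_sum_right)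

lemma qform_conj: "qform (adjoint_mat Y ** X ** Y) v = qform X (Y *v v)"
  by (simp add: qform_eq_inner inner_adjoint matrix_vector_mul_assoc matrix_mul_assoc)

lemma qform_mix: "qform (mix \<rho> p) v = (\<Sum>x\<in>UNIV. p x * qform (\<rho> x) v)"
proof -
  have "(mix \<rho> p *v v) = (\<Sum>x\<in>UNIV. p x *\<^sub>R (\<rho> x *v v))"
    by (simp add: mix_def vec_eq_iff matrix_vector_mult_def sum_distrib_right scaleR_sum_right)
       (intro allI sum.swap)
  then show ?thesis by (simp add: qform_eq_inner inner_sum_right)
qed

lemma hermitian_mix: "(\<And>x. hermitian_mat (\<rho> x)) \<Longrightarrow> hermitian_mat (mix \<rho> p)"
  by (simp add: hermitian_mat_def mix_def vec_eq_iff)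

lemma psd_mix:
  assumes "\<And>x. psd_mat (\<rho> x)" "\<And>x. 0 \<le> p x"
  shows "psd_mat (mix \<rho> p)"
  using assms hermitian_mix[of \<rho> p] by (auto simp: psd_mat_iff_qform qform_mix intro!: sum_nonneg)

section \<open>Functional calculus in a fixed eigenbasis\<close>

definition spec_mat :: "complex^'m^'m \<Rightarrow> ('m \<Rightarrow> real) \<Rightarrow> complex^'m^'m" where
  "spec_mat U f = U ** diag_mat (\<lambda>i. complex_of_real (f i)) ** adjoint_mat U"

lemma mult_diag_mat: "(A ** diag_mat d) $ i $ j = A $ i $ j * d j"
  by (simp add: diag_mat_def matrix_matrix_mult_def if_distrib if_distribR cong: if_cong)

lemma diag_mat_mult: "diag_mat d ** diag_mat e = diag_mat (\<lambda>i. d i * e i)"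
  by (simp add: vec_eq_iff mult_diag_mat) (simp add: diag_mat_def)

lemma spec_mat_nth: "spec_mat U f $ i $ j = (\<Sum>k\<in>UNIV. U $ i $ k * f k * cnj (U $ j $ k))"
  by (simp add: spec_mat_def matrix_matrix_mult_def[of "U ** _"] mult_diag_mat)

lemma spec_mat_mult:
  assumes "unitary_mat U"
  shows "spec_mat U f ** spec_mat U g = spec_mat U (\<lambda>i. f i * g i)"
proof -
  have "spec_mat U f ** spec_mat U g =
      U ** (diag_mat (\<lambda>i. f i) ** ((adjoint_mat U ** U) ** diag_mat (\<lambda>i. g i))) ** adjoint_mat U"
    by (simp add: spec_mat_def matrix_mul_assoc)
  also have "\<dots> = spec_mat U (\<lambda>i. f i * g i)"
    using assms by (simp add: unitary_mat_def diag_mat_mult spec_mat_def)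
  finally show ?thesis .
qed

lemma spec_mat_one: "unitary_mat U \<Longrightarrow> spec_mat U (\<lambda>i. 1) = mat 1"
proof -
  assume "unitary_mat U"
  then have "U ** adjoint_mat U = mat 1"
    by (simp add: unitary_mat_def matrix_left_right_inverse)
  moreover have "diag_mat (\<lambda>i::'a. 1::complex) = mat 1"
    by (simp add: diag_mat_def mat_def)
  ultimately show ?thesis by (simp add: spec_mat_def)
qed

lemma adjoint_spec_mat: "adjoint_mat (spec_mat U f) = spec_mat U f"
  by (simp add: vec_eq_iff spec_mat_nth algebra_simps)

lemma spec_mat_add: "spec_mat U f + spec_mat U g = spec_mat U (\<lambda>i. f i + g i)"
  by (simp add: vec_eq_iff spec_mat_nth algebra_simps sum.distrib)

lemma spec_mat_scaleR: "c *\<^sub>R spec_mat U f = spec_mat U (\<lambda>i. c * f i)"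
  by (simp add: vec_eq_iff spec_mat_nth scaleR_sum_right) (simp add: scaleR_conv_of_real mult_ac)

text \<open>Cyclicity of the trace moves \<open>U\<close> onto \<open>X\<close>. Traces against
  logarithms and resolvents thus become weighted scalar sums over eigenvectors.\<close>

lemma Re_trace_spec_mat:
  "Re (trace (X ** spec_mat U f)) = (\<Sum>j\<in>UNIV. f j * qform X (column j U))"
proof -
  have "trace (X ** spec_mat U f) = trace (diag_mat (\<lambda>i. f i) ** (adjoint_mat U ** X ** U))"
    by (metis (no_types) spec_mat_def matrix_mul_assoc trace_mul_sym)
  also have "\<dots> = trace ((adjoint_mat U ** X ** U) ** diag_mat (\<lambda>i. f i))"
    by (rule trace_mul_sym)
  also have "\<dots> = (\<Sum>j\<in>UNIV. (\<Sum>i\<in>UNIV. \<Sum>k\<in>UNIV. cnj (U $ i $ j) * X $ i $ k * U $ k $ j) * f j)"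
    unfolding trace_def mult_diag_mat
    by (simp add: matrix_matrix_mult_def sum_distrib_right sum_distrib_left mult.assoc)
       (rule sum.cong[OF refl], rule sum.swap)
  finally show ?thesis
    by (simp add: qform_def column_def mult.commute)
qed

lemma sum_qform_column:
  "unitary_mat U \<Longrightarrow> (\<Sum>j\<in>UNIV. qform X (column j U)) = Re (trace X)"
  using Re_trace_spec_mat[of X U "\<lambda>_. 1"] by (simp add: spec_mat_one)

lemma unitary_column_inner:
  assumes "unitary_mat U"
  shows "(\<Sum>k\<in>UNIV. cnj (U $ k $ i) * U $ k $ j) = (if i = j then 1 else 0)"
proof -
  have "(adjoint_mat U ** U) $ i $ j = (mat 1 :: complex^'a^'a) $ i $ j"
    using assms by (simp add: unitary_mat_def)
  then show ?thesis by (simp add: matrix_matrix_mult_def mat_def)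
qed

lemma qform_spec_mat_column:
  assumes "unitary_mat U"
  shows "qform (spec_mat U f) (column j U) = f j"
proof -
  have "spec_mat U f *v column j U = f j *\<^sub>R column j U"
  proof -
    have "spec_mat U f ** U = U ** diag_mat (\<lambda>i. f i)"
      using assms by (simp add: spec_mat_def unitary_mat_def flip: matrix_mul_assoc)
    then have "(spec_mat U f ** U) $ i $ j = U $ i $ j * f j" for i by (simp add: mult_diag_mat)
    then show ?thesis
      by (simp add: vec_eq_iff matrix_vector_mult_def column_def scaleR_conv_of_real[where 'a=complex]
          matrix_matrix_mult_def mult.commute)
  qed
  moreover have "inner (column j U) (column j U) = 1"
    using arg_cong[OF unitary_column_inner[OF assms, of j j], of Re]
    by (simp add: inner_vec_def column_def inner_complex_def)
  ultimately show ?thesis by (simp add: qform_eq_inner)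
qed

section \<open>Spectral theorem for Hermitian matrices\<close>

text \<open>The vectors \<open>V i\<close> and \<open>\<i> *s V i\<close> span a real subspace of
  dimension at most \<open>2 * card I\<close>, less than the real dimension of the whole
  space.\<close>

lemma exists_cprod_orthogonal:
  fixes V :: "'m \<Rightarrow> complex^'m"
  assumes "I \<noteq> UNIV"
  shows "\<exists>v. norm v = 1 \<and> (\<forall>i\<in>I. cprod (V i) v = 0)"
proof -
  define S where "S = V ` I \<union> (\<lambda>i. \<i> *s V i) ` I"
  have "card I < CARD('m)" using assms by (simp add: psubset_card_mono psubset_eq)
  have "dim S \<le> card S" by (rule dim_le_card) (auto simp: S_def span_base)
  also have "\<dots> \<le> card I + card I"
    unfolding S_def by (intro order.trans[OF card_Un_le] add_mono card_image_le) auto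
  also have "\<dots> < DIM(complex^'m)" using \<open>card I < _\<close> by simp
  finally obtain w where w: "w \<noteq> 0" "\<And>y. y \<in> span S \<Longrightarrow> orthogonal w y"
    using orthogonal_to_subspace_exists by blast
  have "cprod (V i) w = 0" if "i \<in> I" for i
  proof (rule complex_eqI)
    have "V i \<in> span S" "\<i> *s V i \<in> span S" using that by (auto simp: S_def span_base)
    then show "Re (cprod (V i) w) = Re 0" "Im (cprod (V i) w) = Im 0"
      using w(2) by (simp_all add: Re_cprod Im_cprod orthogonal_def inner_commute[of _ w])
  qed
  then show ?thesis using w(1)
    by (intro exI[of _ "w /\<^sub>R norm w"]) (simp add: cprod_simps)
qed

lemma quadratic_nonneg_imp_linear_zero:
  fixes b c :: real
  assumes "\<And>t. 0 \<le> 2 * t * b + t\<^sup>2 * c"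
  shows "b = 0"
proof (rule ccontr)
  assume "b \<noteq> 0"
  \<comment> \<open>The choice gives \<open>C > 0\<close> and \<open>C > c\<close> whatever the sign
    of \<open>c\<close>, so at \<open>t = - b / C\<close> the linear term outweighs the quadratic
    one.\<close>
  define C where "C = \<bar>c\<bar> + 1"
  have "C > 0" "c < C" by (auto simp: C_def)
  have "2 * (- b / C) * b + (- b / C)\<^sup>2 * c = b\<^sup>2 / C * (c / C - 2)"
    using \<open>C > 0\<close> by (simp add: power2_eq_square field_simps)
  moreover have "c / C - 2 < 0" using \<open>C > 0\<close> \<open>c < C\<close> by (simp add: field_simps)
  moreover have "b\<^sup>2 / C > 0" using \<open>b \<noteq> 0\<close> \<open>C > 0\<close> by simp
  ultimately show False using assms[of "- b / C"] by (metis mult_pos_neg not_le)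
qed

text \<open>The orthogonal complement \<open>W\<close> of the given eigenvectors is invariant under
  \<open>A\<close>, and a maximiser of the quadratic form on its unit sphere is an
  eigenvector.\<close>

lemma exists_eigenvector_orthogonal:
  fixes V :: "'m \<Rightarrow> complex^'m"
  assumes "hermitian_mat A" "I \<noteq> UNIV" and eig: "\<And>i. i \<in> I \<Longrightarrow> A *v V i = d i *\<^sub>R V i"
  shows "\<exists>v e. norm v = 1 \<and> (\<forall>i\<in>I. cprod (V i) v = 0) \<and> A *v v = e *\<^sub>R v"
proof -
  define W where "W = {w. \<forall>i\<in>I. cprod (V i) w = 0}"
  have W: "v + w \<in> W" "r *\<^sub>R v \<in> W" "v - w \<in> W" if "v \<in> W" "w \<in> W" for v w r
    using that by (auto simp: W_def cprod_simps)
  have AW: "A *v w \<in> W" if "w \<in> W" for w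
  proof -
    have "cprod (V i) (A *v w) = 0" if "i \<in> I" for i
    proof -
      have "cprod (V i) (A *v w) = cprod (d i *\<^sub>R V i) w"
        using assms(1) eig[OF that] cprod_adjoint[of A "V i" w] by (simp add: hermitian_mat_def)
      also have "\<dots> = cnj (d i *\<^sub>R cprod w (V i))" by (subst cprod_commute) (simp add: cprod_simps)
      also have "\<dots> = d i *\<^sub>R cprod (V i) w" by (subst (2) cprod_commute) simp
      also have "\<dots> = 0" using \<open>w \<in> W\<close> that by (simp add: W_def)
      finally show ?thesis .
    qed
    then show ?thesis by (simp add: W_def)
  qed
  have "W = (\<Inter>i\<in>I. {w. cprod (V i) w = 0})" by (auto simp: W_def)
  moreover have "closed {w. cprod (V i) w = 0}" for i
    unfolding cprod_def by (intro closed_Collect_eq continuous_intros)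
  ultimately have "closed W" by (simp add: closed_INT)
  then have comp: "compact (sphere 0 1 \<inter> W)" by (intro compact_Int_closed) auto
  have ne: "sphere 0 1 \<inter> W \<noteq> {}"
    using exists_cprod_orthogonal[OF assms(2), of V] by (auto simp: W_def)
  have "continuous_on (sphere 0 1 \<inter> W) (qform A)"
    unfolding qform_def by (intro continuous_intros)
  from continuous_attains_sup[OF comp ne this]
  obtain v where v: "norm v = 1" "v \<in> W" and max: "\<And>w. norm w = 1 \<Longrightarrow> w \<in> W \<Longrightarrow> qform A w \<le> qform A v"
    by auto
  define e where "e = qform A v"
  have bound: "qform A w \<le> e * (norm w)\<^sup>2" if "w \<in> W" for w
  proof (cases "w = 0")
    case False
    have "qform A (w /\<^sub>R norm w) \<le> e"
      unfolding e_def using False W(2)[OF that that] by (intro max) auto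
    moreover have "qform A (w /\<^sub>R norm w) = qform A w / (norm w)\<^sup>2"
      by (simp only: qform_eq_inner mat_vec_scaleR) (simp add: divide_inverse power2_eq_square)
    ultimately have "qform A w / (norm w)\<^sup>2 \<le> e" by simp
    then show ?thesis using False by (subst (asm) pos_divide_le_eq) auto
  qed (simp add: qform_eq_inner)
  have sym: "inner (A *v x) y = inner x (A *v y)" for x y
    using assms(1) inner_adjoint[of A x y] by (simp add: hermitian_mat_def)
  \<comment> \<open>The residual of the eigenvalue equation is itself the direction of perturbation:
    the first-order term of \<open>bound\<close> at \<open>v + t *\<^sub>R w\<close> is
    \<open>inner w w\<close>, which must vanish.\<close>
  define w where "w = e *\<^sub>R v - A *v v"
  have "w \<in> W" using v AW W by (simp add: w_def)
  have "0 \<le> 2 * t * inner w w + t\<^sup>2 * (e * (norm w)\<^sup>2 - qform A w)" for t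
  proof -
    have "qform A (v + t *\<^sub>R w) \<le> e * (norm (v + t *\<^sub>R w))\<^sup>2"
      using v \<open>w \<in> W\<close> W by (intro bound) auto
    moreover have "qform A (v + t *\<^sub>R w) = e + 2 * t * inner (A *v v) w + t\<^sup>2 * qform A w"
      by (simp add: qform_eq_inner e_def mat_vec_scaleR
          sym[of v w, symmetric] inner_commute[of w "A *v v"]
          power2_eq_square algebra_simps)
    moreover have "(norm (v + t *\<^sub>R w))\<^sup>2 = 1 + 2 * t * inner v w + t\<^sup>2 * (norm w)\<^sup>2"
      using v(1) unfolding power2_norm_eq_inner norm_eq_1
      by (simp add: inner_commute power2_eq_square algebra_simps)
    moreover have "inner (A *v v) w = e * inner v w - inner w w"
      by (simp add: w_def inner_diff_left)
    ultimately show ?thesis by (simp add: algebra_simps)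
  qed
  then have "inner w w = 0" by (rule quadratic_nonneg_imp_linear_zero)
  then have "A *v v = e *\<^sub>R v" by (simp add: w_def)
  then show ?thesis using v by (auto simp: W_def)
qed

text \<open>Orthonormal eigenvectors are added one at a time by induction on the index set; a full
  family forms the columns of \<open>U\<close>.\<close>

theorem hermitian_spectral:
  assumes "hermitian_mat A"
  shows "\<exists>U d. unitary_mat U \<and> A = spec_mat U d"
proof -
  have "\<exists>V d. (\<forall>i\<in>I. A *v V i = d i *\<^sub>R V i) \<and>
      (\<forall>i\<in>I. \<forall>j\<in>I. cprod (V i) (V j) = (if i = j then 1 else 0))"
    if "finite I" for I :: "'a set"
    using that
  proof induction
    case (insert k I)
    then obtain V d where V: "\<And>i. i \<in> I \<Longrightarrow> A *v V i = d i *\<^sub>R V i"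
      "\<And>i j. i \<in> I \<Longrightarrow> j \<in> I \<Longrightarrow> cprod (V i) (V j) = (if i = j then 1 else 0)" by blast
    have "I \<noteq> UNIV" using insert.hyps by auto
    then obtain v e where v: "norm v = 1" "\<And>i. i \<in> I \<Longrightarrow> cprod (V i) v = 0" "A *v v = e *\<^sub>R v"
      using exists_eigenvector_orthogonal[OF assms, of I V d] V(1) by blast
    have "cprod v (V i) = 0" if "i \<in> I" for i using v(2)[OF that] cprod_commute[of v "V i"] by simp
    moreover have "cprod v v = 1"
      using v(1) cprod_commute[of v v] Re_cprod[of v v]
      by (simp add: complex_eq_iff norm_eq_1)
    ultimately show ?case using V v insert.hyps
      by (intro exI[of _ "V(k := v)"] exI[of _ "d(k := e)"]) auto
  qed simp
  from this[of UNIV] obtain V :: "'a \<Rightarrow> complex^'a" and d where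
    V: "\<And>i. A *v V i = d i *\<^sub>R V i" "\<And>i j. cprod (V i) (V j) = (if i = j then 1 else 0)" by auto
  define U where "U = (\<chi> i j. V j $ i)"
  have U: "unitary_mat U"
    using V(2) by (simp add: unitary_mat_def vec_eq_iff matrix_matrix_mult_def mat_def U_def cprod_def)
  have "(A ** U) $ i $ j = U $ i $ j * d j" for i j
    using arg_cong[OF V(1)[of j], of "\<lambda>v. v $ i"]
    by (simp add: U_def matrix_matrix_mult_def matrix_vector_mult_def
        scaleR_conv_of_real[where 'a=complex] mult.commute)
  then have AU: "A ** U = U ** diag_mat (\<lambda>i. complex_of_real (d i))"
    by (simp add: vec_eq_iff mult_diag_mat)
  have "U ** adjoint_mat U = mat 1"
    using U by (simp add: unitary_mat_def matrix_left_right_inverse)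
  then have "A = A ** U ** adjoint_mat U" by (simp flip: matrix_mul_assoc)
  also have "\<dots> = spec_mat U d" by (simp add: AU spec_mat_def)
  finally show ?thesis using U by blast
qed

text \<open>The \<open>SOME\<close> in \<open>mat_ln\<close> comes with a decomposition of
  \<open>A\<close>, once the spectral theorem shows that one exists. In that basis \<open>A\<close>
  and its logarithm are both diagonal.\<close>

lemma mat_ln_spec:
  assumes "psd_mat A"
  obtains U d where "unitary_mat U" "\<And>i. 0 \<le> d i" "A = spec_mat U d"
    "mat_ln A = spec_mat U (\<lambda>i. ln (d i))"
proof -
  obtain U0 d0 where "unitary_mat U0" "A = spec_mat U0 d0"
    using hermitian_spectral assms psd_mat_def by blast
  then have "\<exists>L U d. unitary_mat U \<and> A = spec_mat U d \<and>
      L = spec_mat U (\<lambda>i. if d i > 0 then ln (d i) else 0)" by blast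
  from someI_ex[OF this] obtain U d where Ud: "unitary_mat U" "A = spec_mat U d"
    "mat_ln A = spec_mat U (\<lambda>i. if d i > 0 then ln (d i) else 0)"
    unfolding mat_ln_def spec_mat_def by blast
  have d: "0 \<le> d i" for i
    using assms qform_spec_mat_column[OF Ud(1), of d i] Ud(2) by (metis psd_mat_iff_qform)
  \<comment> \<open>Since \<open>ln 0 = 0\<close> and no eigenvalue is negative, the convention on
    the support is plain \<open>ln\<close>.\<close>
  then have "(\<lambda>i. if d i > 0 then ln (d i) else 0) = (\<lambda>i. ln (d i))"
    by (auto simp: fun_eq_iff less_le)
  with Ud(3) show ?thesis by (intro that[OF Ud(1) d Ud(2)]) simp
qed

subsection \<open>Scalar inequalities\<close>

text \<open>The difference \<open>G(s)\<close> of the two sums with \<open>s\<close> added inside the logarithms is nondecreasing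
  and, the total masses being equal, tends to \<open>0\<close> at infinity. A zero value carries zero weight, so the
  junk value \<open>ln 0 = 0\<close> is harmless as \<open>s\<close> tends to \<open>0\<close>.\<close>
lemma sum_ln_le_of_sum_inverse_ge:
  fixes \<alpha> a :: "'k \<Rightarrow> real" and \<beta> b :: "'l \<Rightarrow> real"
  assumes fin: "finite K" "finite L"
    and a: "\<And>k. k \<in> K \<Longrightarrow> 0 \<le> a k" "\<And>k. k \<in> K \<Longrightarrow> a k = 0 \<Longrightarrow> \<alpha> k = 0"
    and b: "\<And>l. l \<in> L \<Longrightarrow> 0 \<le> b l" "\<And>l. l \<in> L \<Longrightarrow> b l = 0 \<Longrightarrow> \<beta> l = 0"
    and mass: "sum \<alpha> K = sum \<beta> L"
    and ineq: "\<And>s. s > 0 \<Longrightarrow> (\<Sum>l\<in>L. \<beta> l / (b l + s)) \<le> (\<Sum>k\<in>K. \<alpha> k / (a k + s))"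
  shows "(\<Sum>k\<in>K. \<alpha> k * ln (a k)) \<le> (\<Sum>l\<in>L. \<beta> l * ln (b l))"
proof -
  define G where "G = (\<lambda>s. (\<Sum>k\<in>K. \<alpha> k * ln (a k + s)) - (\<Sum>l\<in>L. \<beta> l * ln (b l + s)))"
  have deriv: "(G has_real_derivative
      (\<Sum>k\<in>K. \<alpha> k / (a k + s)) - (\<Sum>l\<in>L. \<beta> l / (b l + s))) (at s)" if "s > 0" for s
    unfolding G_def using a(1) b(1) that
    by (auto intro!: derivative_eq_intros sum.cong simp: add_nonneg_pos less_imp_neq[symmetric])
  have mono: "G s \<le> G u" if "0 < s" "s \<le> u" for s u
  proof (rule DERIV_nonneg_imp_nondecreasing[OF that(2)])
    fix x assume "s \<le> x" "x \<le> u"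
    then show "\<exists>y. (G has_real_derivative y) (at x) \<and> 0 \<le> y"
      using deriv[of x] ineq[of x] that by (intro exI conjI) auto
  qed
  have lim1: "((\<lambda>s. ln (c + s) - ln s) \<longlongrightarrow> 0) at_top" for c :: real
    by real_asymp
  \<comment> \<open>Each logarithm is compared with \<open>ln s\<close>; by \<open>mass\<close> the
    subtracted terms cancel between the two sums.\<close>
  have "((\<lambda>s. (\<Sum>k\<in>K. \<alpha> k * (ln (a k + s) - ln s)) - (\<Sum>l\<in>L. \<beta> l * (ln (b l + s) - ln s)))
      \<longlongrightarrow> (\<Sum>k\<in>K. \<alpha> k * 0) - (\<Sum>l\<in>L. \<beta> l * 0)) at_top"
    by (intro tendsto_intros lim1)
  also have "(\<lambda>s. (\<Sum>k\<in>K. \<alpha> k * (ln (a k + s) - ln s)) - (\<Sum>l\<in>L. \<beta> l * (ln (b l + s) - ln s))) = G"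
    by (simp add: G_def right_diff_distrib sum_subtractf mass flip: sum_distrib_right)
  finally have lim_top: "(G \<longlongrightarrow> 0) at_top" by simp
  have nonpos: "G s \<le> 0" if "s > 0" for s
    using tendsto_lowerbound[OF lim_top, of "G s"] mono[OF that]
    by (auto simp: eventually_at_top_linorder)
  have lim2: "((\<lambda>s. w * ln (c + s)) \<longlongrightarrow> w * ln c) (at_right 0)"
    if "0 \<le> c" "c = 0 \<Longrightarrow> w = 0" for w c :: real
  proof (cases "c = 0")
    case False
    have "((\<lambda>s. w * ln (c + s)) \<longlongrightarrow> w * ln (c + 0)) (at_right 0)"
      using False by (intro tendsto_intros) auto
    then show ?thesis by simp
  qed (use that in simp)
  have "(G \<longlongrightarrow> (\<Sum>k\<in>K. \<alpha> k * ln (a k)) - (\<Sum>l\<in>L. \<beta> l * ln (b l))) (at_right 0)"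
    unfolding G_def using a b by (intro tendsto_diff tendsto_sum lim2) auto
  then have "(\<Sum>k\<in>K. \<alpha> k * ln (a k)) - (\<Sum>l\<in>L. \<beta> l * ln (b l)) \<le> 0"
    by (rule tendsto_upperbound) (auto simp: eventually_at_right_less nonpos intro: eventually_mono[OF eventually_at_right_less])
  then show ?thesis by simp
qed

text \<open>Apply \<open>ln y \<le> y - 1\<close> to \<open>y = r x / (q x * Z)\<close> and weight
  by \<open>q x\<close>: the corrections \<open>r x / Z - q x\<close> sum to zero.\<close>

lemma gibbs_inequality:
  fixes q r :: "'n::finite \<Rightarrow> real"
  assumes "q \<in> prob_simplex" "\<And>x. r x > 0"
  shows "(\<Sum>x\<in>UNIV. q x * ln (r x / q x)) \<le> ln (\<Sum>x\<in>UNIV. r x)"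
proof -
  define Z where "Z = (\<Sum>x\<in>UNIV. r x)"
  have q: "\<And>x. 0 \<le> q x" "(\<Sum>x\<in>UNIV. q x) = 1" using assms by (auto simp: prob_simplex_def)
  have Z: "Z > 0" unfolding Z_def by (intro sum_pos) (auto simp: assms)
  have "q x * ln (r x / q x) \<le> q x * ln Z + (r x / Z - q x)" for x
  proof (cases "q x = 0")
    case False
    then have "q x > 0" using q(1)[of x] by simp
    have "ln (r x / q x) - ln Z = ln (r x / (q x * Z))"
      using \<open>q x > 0\<close> Z assms(2)[of x] by (simp add: ln_div ln_mult)
    also have "\<dots> \<le> r x / (q x * Z) - 1"
      using \<open>q x > 0\<close> Z assms(2)[of x] by (intro ln_le_minus_one) simp
    finally have "q x * (ln (r x / q x) - ln Z) \<le> q x * (r x / (q x * Z) - 1)"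
      using \<open>q x > 0\<close> by (intro mult_left_mono) auto
    then show ?thesis using \<open>q x > 0\<close> by (simp add: algebra_simps)
  qed (use assms(2)[of x] Z in simp)
  then have "(\<Sum>x\<in>UNIV. q x * ln (r x / q x)) \<le> (\<Sum>x\<in>UNIV. q x * ln Z + (r x / Z - q x))"
    by (intro sum_mono)
  also have "\<dots> = ln Z"
    using Z q(2) by (simp add: sum.distrib sum_subtractf flip: sum_distrib_right sum_divide_distrib Z_def)
  finally show ?thesis by (simp add: Z_def)
qed

subsection \<open>Relative entropy\<close>

text \<open>A sum of nonnegative terms vanishes only termwise. This is the support inclusion that
  gives zero eigenvalues of a mixture zero weight.\<close>

lemma qform_mix_eq_0:
  assumes "\<And>x. psd_mat (\<rho> x)" "\<And>x. 0 \<le> p x" "qform (mix \<rho> p) v = 0" "p x \<noteq> 0"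
  shows "qform (\<rho> x) v = 0"
proof -
  have "\<forall>x\<in>UNIV. p x * qform (\<rho> x) v = 0"
    using assms by (subst sum_nonneg_eq_0_iff[symmetric])
      (auto simp: qform_mix psd_mat_iff_qform)
  then show ?thesis using assms(4) by auto
qed

lemma Re_trace_mix: "Re (trace (mix \<rho> p ** M)) = (\<Sum>x\<in>UNIV. p x * Re (trace (\<rho> x ** M)))"
proof -
  have "mix \<rho> p ** M = (\<Sum>x\<in>UNIV. p x *\<^sub>R (\<rho> x ** M))"
    by (simp add: mix_def vec_eq_iff matrix_matrix_mult_def sum_distrib_right scaleR_sum_right)
       (intro allI sum.swap)
  then have "Re (trace (mix \<rho> p ** M)) = (\<Sum>i\<in>UNIV. \<Sum>x\<in>UNIV. p x * Re ((\<rho> x ** M) $ i $ i))"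
    by (simp add: trace_def)
  also have "\<dots> = (\<Sum>x\<in>UNIV. \<Sum>i\<in>UNIV. p x * Re ((\<rho> x ** M) $ i $ i))"
    by (rule sum.swap)
  finally show ?thesis by (simp add: trace_def sum_distrib_left)
qed

lemma Re_trace_mix_left: "Re (trace (mix \<rho> p)) = (\<Sum>x\<in>UNIV. p x * Re (trace (\<rho> x)))"
  using Re_trace_mix[of \<rho> p "mat 1"] by simp

text \<open>Cyclicity moves \<open>Y\<close> to both sides of \<open>X\<close>, and the trace is
  then a nonnegative combination of values of its quadratic form.\<close>

lemma Re_trace_psd_conj_nonneg:
  assumes "psd_mat X" "adjoint_mat Y = Y" "\<And>j. 0 \<le> f j"
  shows "0 \<le> Re (trace (X ** (Y ** spec_mat U f ** Y)))"
proof -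
  have "trace (X ** (Y ** spec_mat U f ** Y)) = trace ((adjoint_mat Y ** X ** Y) ** spec_mat U f)"
    by (metis (no_types) assms(2) matrix_mul_assoc trace_mul_sym)
  then have "Re (trace (X ** (Y ** spec_mat U f ** Y))) =
      (\<Sum>j\<in>UNIV. f j * qform X (Y *v column j U))"
    by (simp add: Re_trace_spec_mat qform_conj)
  also have "\<dots> \<ge> 0" using assms by (auto intro!: sum_nonneg simp: psd_mat_iff_qform)
  finally show ?thesis .
qed

lemma mat_mult_simps:
  fixes A B C :: "complex^'m^'m"
  shows "A ** (B + C) = A ** B + A ** C" "(A + B) ** C = A ** C + B ** C"
    "A ** (B - C) = A ** B - A ** C" "(A - B) ** C = A ** C - B ** C"
    "A ** (c *\<^sub>R B) = c *\<^sub>R (A ** B)" "(c *\<^sub>R A) ** B = c *\<^sub>R (A ** B)"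
  by (simp_all add: vec_eq_iff matrix_matrix_mult_def algebra_simps sum.distrib sum_subtractf
      scaleR_sum_right)

lemma Re_trace_simps:
  fixes A B :: "complex^'m^'m"
  shows "Re (trace (A + B)) = Re (trace A) + Re (trace B)"
    "Re (trace (A - B)) = Re (trace A) - Re (trace B)"
    "Re (trace (c *\<^sub>R A)) = c * Re (trace A)"
  by (simp_all add: trace_def sum.distrib sum_subtractf sum_distrib_left)

text \<open>With \<open>A = c\<^sub>x \<rho>\<^sub>p + s\<close> and \<open>B = (\<rho>\<^sub>p\<^sub>' + s)\<^sup>-\<^sup>1\<close>, expand \<open>Tr \<rho>\<^sub>x (A\<^sup>-\<^sup>1 - B) A (A\<^sup>-\<^sup>1 - B) \<ge> 0\<close> and average over
  \<open>x\<close>: the second-order terms recombine because \<open>B (\<rho>\<^sub>p\<^sub>' + s) B = B\<close>.\<close>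
lemma resolvent_trace_ineq:
  fixes \<rho> :: "'n::finite \<Rightarrow> complex^'m^'m"
  assumes psd: "\<And>x. psd_mat (\<rho> x)"
    and p: "\<And>x. 0 \<le> p x" and p': "\<And>x. 0 \<le> p' x"
    and c: "\<And>x. c x > 0" "\<And>x. p x * c x \<le> p' x"
    and U: "unitary_mat U" "\<And>i. 0 \<le> a i" "mix \<rho> p = spec_mat U a"
    and V: "unitary_mat V" "\<And>i. 0 \<le> b i" "mix \<rho> p' = spec_mat V b"
    and s: "s > 0"
  shows "Re (trace (mix \<rho> p ** spec_mat V (\<lambda>i. 1 / (b i + s))))
    \<le> (\<Sum>x\<in>UNIV. p x * Re (trace (\<rho> x ** spec_mat U (\<lambda>i. 1 / (c x * a i + s)))))"
proof -
  define T where "T = (\<lambda>X :: complex^'m^'m. Re (trace X))"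
  define B where "B = spec_mat V (\<lambda>i. 1 / (b i + s))"
  define A where "A = (\<lambda>x. spec_mat U (\<lambda>i. c x * a i + s))"
  define R where "R = (\<lambda>x. spec_mat U (\<lambda>i. 1 / (c x * a i + s)))"
  define \<tau> where "\<tau> = mix \<rho> p"
  have nz: "c x * a i + s > 0" for x i
    using c(1)[of x] U(2)[of i] s by (intro add_nonneg_pos) auto
  have nz': "b i + s > 0" for i using V(2)[of i] s by auto
  have RA: "R x ** A x = mat 1" and AR: "A x ** R x = mat 1" for x
    using nz[of x] by (simp_all add: R_def A_def spec_mat_mult[OF U(1)] spec_mat_one[OF U(1)] less_imp_neq[symmetric])
  have A: "A x = c x *\<^sub>R \<tau> + s *\<^sub>R mat 1" for x
    by (simp add: A_def \<tau>_def U(3) spec_mat_scaleR spec_mat_add flip: spec_mat_one[OF U(1)])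
  have per_x: "2 * T (\<rho> x ** B) - c x * T (\<rho> x ** (B ** \<tau> ** B)) - s * T (\<rho> x ** (B ** B)) \<le> T (\<rho> x ** R x)" for x
  proof -
    have "0 \<le> T (\<rho> x ** ((R x - B) ** A x ** (R x - B)))"
      unfolding T_def A_def
      using psd nz by (intro Re_trace_psd_conj_nonneg)
        (auto simp: R_def B_def adjoint_mat_diff adjoint_spec_mat less_imp_le)
    also have "(R x - B) ** A x ** (R x - B) = R x - B - B + B ** A x ** B"
    proof -
      have "B ** A x ** R x = B" by (simp add: AR flip: matrix_mul_assoc)
      then show ?thesis by (simp add: mat_mult_simps RA algebra_simps)
    qed
    also have "B ** A x ** B = c x *\<^sub>R (B ** \<tau> ** B) + s *\<^sub>R (B ** B)"
      by (simp add: A mat_mult_simps)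
    finally show ?thesis
      unfolding T_def mat_mult_simps Re_trace_simps by linarith
  qed
  \<comment> \<open>Raising \<open>p x * c x\<close> to \<open>p' x\<close> is allowed because it
    multiplies a nonnegative trace that is subtracted; these terms then sum to a trace against
    \<open>mix \<rho> p'\<close>.\<close>
  have "p x * (2 * T (\<rho> x ** B)) - p' x * T (\<rho> x ** (B ** \<tau> ** B)) - s * (p x * T (\<rho> x ** (B ** B)))
      \<le> p x * T (\<rho> x ** R x)" for x
  proof -
    have "0 \<le> T (\<rho> x ** (B ** \<tau> ** B))"
      unfolding T_def \<tau>_def U(3)
      by (intro Re_trace_psd_conj_nonneg psd U) (simp add: B_def adjoint_spec_mat)
    then have "p x * c x * T (\<rho> x ** (B ** \<tau> ** B)) \<le> p' x * T (\<rho> x ** (B ** \<tau> ** B))"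
      by (intro mult_right_mono c)
    with mult_left_mono[OF per_x[of x] p[of x]] show ?thesis by (simp add: algebra_simps)
  qed
  then have "(\<Sum>x\<in>UNIV. p x * (2 * T (\<rho> x ** B)) - p' x * T (\<rho> x ** (B ** \<tau> ** B)) - s * (p x * T (\<rho> x ** (B ** B))))
      \<le> (\<Sum>x\<in>UNIV. p x * T (\<rho> x ** R x))" by (intro sum_mono)
  also have "(\<Sum>x\<in>UNIV. p x * (2 * T (\<rho> x ** B)) - p' x * T (\<rho> x ** (B ** \<tau> ** B)) - s * (p x * T (\<rho> x ** (B ** B))))
     = 2 * T (\<tau> ** B) - T (mix \<rho> p' ** (B ** \<tau> ** B)) - s * T (\<tau> ** (B ** B))"
    by (simp add: T_def \<tau>_def Re_trace_mix sum_subtractf sum.distrib sum_distrib_left algebra_simps)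
  \<comment> \<open>Cyclicity exchanges \<open>\<tau>\<close> and \<open>mix \<rho> p'\<close>,
    putting the latter between the two factors \<open>B\<close>, its shifted inverse.\<close>
  also have "T (mix \<rho> p' ** (B ** \<tau> ** B)) = T (\<tau> ** (B ** mix \<rho> p' ** B))"
    by (metis (no_types) T_def matrix_mul_assoc trace_mul_sym)
  also have "2 * T (\<tau> ** B) - T (\<tau> ** (B ** mix \<rho> p' ** B)) - s * T (\<tau> ** (B ** B)) =
      2 * T (\<tau> ** B) - T (\<tau> ** (B ** mix \<rho> p' ** B + s *\<^sub>R (B ** B)))"
    by (simp add: T_def mat_mult_simps Re_trace_simps)
  also have "B ** mix \<rho> p' ** B + s *\<^sub>R (B ** B) = B"
  proof -
    have "1 / (b i + s) * b i * (1 / (b i + s)) + s * (1 / (b i + s) * (1 / (b i + s))) = 1 / (b i + s)" for i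
      using nz'[of i] by (simp add: divide_simps)
    then show ?thesis
      by (simp only: B_def V(3) spec_mat_mult[OF V(1)] spec_mat_scaleR spec_mat_add)
  qed
  finally show ?thesis by (simp add: T_def \<tau>_def B_def R_def)
qed

text \<open>Data processing for the map \<open>p \<mapsto> mix \<rho> p\<close>. The scalar lemma
  turns the resolvent inequality into logarithms, with the numbers \<open>c x * a j\<close> over
  pairs on one side and the eigenvalues \<open>b i\<close> on the other.\<close>

theorem relative_entropy_mix_le:
  fixes \<rho> :: "'n::finite \<Rightarrow> complex^'m^'m"
  assumes dens: "\<And>x. density_mat (\<rho> x)"
    and p: "p \<in> prob_simplex" and p': "p' \<in> prob_simplex"
    and ac: "\<And>x. p' x = 0 \<Longrightarrow> p x = 0"
  shows "(\<Sum>x\<in>UNIV. p x * ln (p' x / p x)) + Re (trace (mix \<rho> p ** mat_ln (mix \<rho> p)))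
     \<le> Re (trace (mix \<rho> p ** mat_ln (mix \<rho> p')))"
proof -
  have psd: "\<And>x. psd_mat (\<rho> x)" and tr: "\<And>x. Re (trace (\<rho> x)) = 1"
    using dens by (auto simp: density_mat_def)
  have pnn: "\<And>x. 0 \<le> p x" "\<And>x. 0 \<le> p' x" and psum: "sum p UNIV = 1"
    using p p' by (auto simp: prob_simplex_def)
  have psds: "psd_mat (mix \<rho> p)" "psd_mat (mix \<rho> p')" by (intro psd_mix psd pnn)+
  from psds(1) obtain U a where U: "unitary_mat U" "\<And>i. 0 \<le> a i" "mix \<rho> p = spec_mat U a"
    "mat_ln (mix \<rho> p) = spec_mat U (\<lambda>i. ln (a i))" by (rule mat_ln_spec) (rule that)
  from psds(2) obtain V b where V: "unitary_mat V" "\<And>i. 0 \<le> b i" "mix \<rho> p' = spec_mat V b"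
    "mat_ln (mix \<rho> p') = spec_mat V (\<lambda>i. ln (b i))" by (rule mat_ln_spec) (rule that)
  \<comment> \<open>The likelihood ratio; the value 1 at \<open>p x = 0\<close> keeps
    \<open>c\<close> positive and carries no weight.\<close>
  define c where "c = (\<lambda>x. if p x = 0 then 1 else p' x / p x)"
  have c: "c x > 0" "p x * c x \<le> p' x" for x
    using pnn[of x] ac[of x] by (auto simp: c_def less_le)
  define \<alpha> where "\<alpha> = (\<lambda>(x, j). p x * qform (\<rho> x) (column j U))"
  define \<beta> where "\<beta> = (\<lambda>i. qform (mix \<rho> p) (column i V))"
  have \<alpha>0: "\<alpha> (x, j) = 0" if "a j = 0" for x j
  proof -
    have "qform (mix \<rho> p) (column j U) = 0"
      using that U by (simp add: qform_spec_mat_column)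
    then show ?thesis
      using qform_mix_eq_0[of \<rho> p, OF psd pnn(1)] by (auto simp: \<alpha>_def)
  qed
  have \<beta>0: "\<beta> j = 0" if "b j = 0" for j
  proof -
    have "qform (mix \<rho> p') (column j V) = 0"
      using that V by (simp add: qform_spec_mat_column)
    then have "p x * qform (\<rho> x) (column j V) = 0" for x
      using qform_mix_eq_0[of \<rho> p', OF psd pnn(2)] ac by auto
    then show ?thesis by (simp only: \<beta>_def qform_mix sum.neutral_const)
  qed
  have sum_pair: "(\<Sum>k\<in>UNIV. \<alpha> k * f k) = (\<Sum>x\<in>UNIV. p x * (\<Sum>j\<in>UNIV. f (x, j) * qform (\<rho> x) (column j U)))"
    for f :: "'n \<times> 'm \<Rightarrow> real"
  proof -
    have "(\<Sum>k\<in>UNIV. \<alpha> k * f k) = (\<Sum>x\<in>UNIV. \<Sum>j\<in>UNIV. \<alpha> (x, j) * f (x, j))"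
      by (simp add: sum.cartesian_product)
    then show ?thesis by (simp add: \<alpha>_def sum_distrib_left mult_ac)
  qed
  have "(\<Sum>k\<in>UNIV. \<alpha> k * ln (c (fst k) * a (snd k))) \<le> (\<Sum>i\<in>UNIV. \<beta> i * ln (b i))"
  proof (rule sum_ln_le_of_sum_inverse_ge)
    fix k :: "'n \<times> 'm"
    show "0 \<le> c (fst k) * a (snd k)" using c(1)[of "fst k"] U(2) by simp
    show "\<alpha> k = 0" if "c (fst k) * a (snd k) = 0"
      using that c(1)[of "fst k"] \<alpha>0[of "snd k" "fst k"] by auto
  next
    have "sum \<alpha> UNIV = 1"
      using sum_pair[of "\<lambda>_. 1"] by (simp add: sum_qform_column[OF U(1)] tr psum)
    moreover have "sum \<beta> UNIV = 1"
      by (simp add: \<beta>_def sum_qform_column[OF V(1)] Re_trace_mix_left tr psum)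
    ultimately show "sum \<alpha> UNIV = sum \<beta> UNIV" by simp
  next
    fix s :: real assume "s > 0"
    from resolvent_trace_ineq[OF psd pnn c U(1-3) V(1-3) this]
    show "(\<Sum>i\<in>UNIV. \<beta> i / (b i + s)) \<le> (\<Sum>k\<in>UNIV. \<alpha> k / (c (fst k) * a (snd k) + s))"
      using sum_pair[of "\<lambda>(x, j). 1 / (c x * a j + s)"]
      by (simp add: Re_trace_spec_mat \<beta>_def case_prod_beta)
  qed (use V \<beta>0 in auto)
  \<comment> \<open>The logarithm of the product does not split where \<open>a\<close> is zero, but
    \<open>\<alpha>\<close> vanishes there.\<close>
  also have "(\<Sum>k\<in>UNIV. \<alpha> k * ln (c (fst k) * a (snd k))) =
      (\<Sum>k\<in>UNIV. \<alpha> k * (ln (c (fst k)) + ln (a (snd k))))"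
  proof (intro sum.cong refl)
    fix k :: "'n \<times> 'm"
    show "\<alpha> k * ln (c (fst k) * a (snd k)) = \<alpha> k * (ln (c (fst k)) + ln (a (snd k)))"
      using \<alpha>0[of "snd k" "fst k"] c(1)[of "fst k"] U(2)[of "snd k"]
      by (cases "a (snd k) = 0") (simp_all add: ln_mult)
  qed
  also have "\<dots> = (\<Sum>x\<in>UNIV. p x * ln (c x)) + Re (trace (mix \<rho> p ** mat_ln (mix \<rho> p)))"
    unfolding sum_pair U(4) Re_trace_mix
    by (simp add: Re_trace_spec_mat distrib_right sum.distrib distrib_left sum_qform_column[OF U(1)] tr flip: sum_distrib_left)
  also have "(\<Sum>x\<in>UNIV. p x * ln (c x)) = (\<Sum>x\<in>UNIV. p x * ln (p' x / p x))"
    by (intro sum.cong) (auto simp: c_def)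
  also have "(\<Sum>i\<in>UNIV. \<beta> i * ln (b i)) = Re (trace (mix \<rho> p ** mat_ln (mix \<rho> p')))"
    by (simp add: V(4) Re_trace_spec_mat \<beta>_def mult.commute)
  finally show ?thesis .
qed

section \<open>Klein's inequality\<close>

lemma qform_spec_mat:
  "qform (spec_mat U f) v = (\<Sum>j\<in>UNIV. f j * (cmod (cprod (column j U) v))\<^sup>2)"
proof -
  have nth: "(adjoint_mat U *v v) $ j = cprod (column j U) v" for j
    by (simp add: matrix_vector_mult_def cprod_def column_def)
  have "qform (spec_mat U f) v = qform (diag_mat (\<lambda>i. complex_of_real (f i))) (adjoint_mat U *v v)"
    using qform_conj[of "adjoint_mat U"] by (simp add: spec_mat_def)
  also have "\<dots> = (\<Sum>j\<in>UNIV. f j * (cmod ((adjoint_mat U *v v) $ j))\<^sup>2)"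
    unfolding qform_def diag_mat_def cmod_power2
    by (simp add: if_distrib if_distribR sum.distrib power2_eq_square algebra_simps cong: if_cong)
  finally show ?thesis by (simp add: nth)
qed

text \<open>The squared overlaps \<open>P i j\<close> of the two eigenbases form a doubly stochastic
  matrix. This reduces the claim to \<open>a * ln b - a * ln a \<le> b - a\<close> for pairs of
  eigenvalues, and the right sides cancel in total since the traces agree.\<close>

theorem klein_inequality:
  assumes A: "psd_mat A" and B: "psd_mat B" and tr: "Re (trace A) = Re (trace B)"
    and supp: "\<And>v. qform B v = 0 \<Longrightarrow> qform A v = 0"
  shows "Re (trace (A ** mat_ln B)) \<le> Re (trace (A ** mat_ln A))"
proof -
  from A obtain U a where U: "unitary_mat U" "\<And>i. 0 \<le> a i" "A = spec_mat U a"
    "mat_ln A = spec_mat U (\<lambda>i. ln (a i))" by (rule mat_ln_spec) (rule that)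
  from B obtain V b where V: "unitary_mat V" "\<And>i. 0 \<le> b i" "B = spec_mat V b"
    "mat_ln B = spec_mat V (\<lambda>i. ln (b i))" by (rule mat_ln_spec) (rule that)
  define P where "P = (\<lambda>i j. (cmod (cprod (column j U) (column i V)))\<^sup>2)"
  have P_sym: "P i j = (cmod (cprod (column i V) (column j U)))\<^sup>2" for i j
    unfolding P_def by (subst cprod_commute) simp
  have row: "(\<Sum>j\<in>UNIV. P i j) = 1" for i
    using qform_spec_mat[of U "\<lambda>_. 1" "column i V"] qform_spec_mat_column[OF V(1), of "\<lambda>_. 1" i]
    by (simp add: P_def spec_mat_one U V)
  have col: "(\<Sum>i\<in>UNIV. P i j) = 1" for j
    using qform_spec_mat[of V "\<lambda>_. 1" "column j U"] qform_spec_mat_column[OF U(1), of "\<lambda>_. 1" j]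
    by (simp add: P_sym spec_mat_one U V)
  have qA: "qform A (column i V) = (\<Sum>j\<in>UNIV. a j * P i j)" for i
    by (simp add: U(3) qform_spec_mat P_def)
  have tA: "(\<Sum>j\<in>UNIV. a j) = Re (trace A)" and tB: "(\<Sum>j\<in>UNIV. b j) = Re (trace B)"
    using sum_qform_column[OF U(1), of A] sum_qform_column[OF V(1), of B] U V
    by (simp_all add: qform_spec_mat_column)
  have le: "P i j * (a j * ln (b i) - a j * ln (a j)) \<le> P i j * (b i - a j)" for i j
  proof (cases "a j = 0")
    case False
    then have "a j > 0" using U(2)[of j] by simp
    show ?thesis
    proof (cases "b i = 0")
      case True
      \<comment> \<open>For \<open>b i = 0\<close> the scalar inequality may fail with
        \<open>ln 0 = 0\<close>; the support condition forces the overlap to vanish instead.\<close>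
      then have "qform A (column i V) = 0"
        using V by (intro supp) (simp add: qform_spec_mat_column)
      then have "\<forall>j\<in>UNIV. a j * P i j = 0"
        unfolding qA using U(2) by (subst sum_nonneg_eq_0_iff[symmetric]) (auto simp: P_def)
      then have "P i j = 0" using \<open>a j > 0\<close> by force
      then show ?thesis by simp
    next
      case False
      then have "b i > 0" using V(2)[of i] by simp
      have "a j * ln (b i / a j) \<le> a j * (b i / a j - 1)"
        using \<open>a j > 0\<close> \<open>b i > 0\<close> by (intro mult_left_mono ln_le_minus_one) auto
      then have "a j * ln (b i) - a j * ln (a j) \<le> b i - a j"
        using \<open>a j > 0\<close> \<open>b i > 0\<close> by (simp add: ln_div algebra_simps)
      then show ?thesis by (intro mult_left_mono) (auto simp: P_def)
    qed
  qed (use V in \<open>simp add: P_def\<close>)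
  have "Re (trace (A ** mat_ln B)) = (\<Sum>i\<in>UNIV. \<Sum>j\<in>UNIV. P i j * (a j * ln (b i)))"
    by (simp add: V(4) Re_trace_spec_mat qA sum_distrib_left mult_ac)
  moreover have "Re (trace (A ** mat_ln A)) = (\<Sum>j\<in>UNIV. (\<Sum>i\<in>UNIV. P i j) * (a j * ln (a j)))"
    by (simp add: col U(4) Re_trace_spec_mat mult_ac) (simp add: U(3) qform_spec_mat_column[OF U(1)] mult.commute)
  moreover have "\<dots> = (\<Sum>i\<in>UNIV. \<Sum>j\<in>UNIV. P i j * (a j * ln (a j)))"
    by (subst sum.swap) (simp add: sum_distrib_right)
  ultimately have "Re (trace (A ** mat_ln B)) - Re (trace (A ** mat_ln A)) =
      (\<Sum>i\<in>UNIV. \<Sum>j\<in>UNIV. P i j * (a j * ln (b i) - a j * ln (a j)))"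
    by (simp add: right_diff_distrib sum_subtractf)
  also have "\<dots> \<le> (\<Sum>i\<in>UNIV. \<Sum>j\<in>UNIV. P i j * (b i - a j))"
    by (intro sum_mono le)
  also have "\<dots> = (\<Sum>i\<in>UNIV. (\<Sum>j\<in>UNIV. P i j) * b i) - (\<Sum>i\<in>UNIV. \<Sum>j\<in>UNIV. P i j * a j)"
    by (simp add: right_diff_distrib sum_subtractf sum_distrib_right)
  also have "(\<Sum>i\<in>UNIV. \<Sum>j\<in>UNIV. P i j * a j) = (\<Sum>j\<in>UNIV. (\<Sum>i\<in>UNIV. P i j) * a j)"
    by (subst sum.swap) (simp add: sum_distrib_right)
  also have "(\<Sum>i\<in>UNIV. (\<Sum>j\<in>UNIV. P i j) * b i) - (\<Sum>j\<in>UNIV. (\<Sum>i\<in>UNIV. P i j) * a j) = 0"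
    by (simp add: row col tA tB tr)
  finally show ?thesis by simp
qed

subsection \<open>Convergence of the Blahut--Arimoto iteration\<close>

text \<open>The quantity \<open>D\<^sub>x(p)\<close> above; \<open>BA_norm\<close> is \<open>Z\<^sub>t\<close>.\<close>
definition gain :: "('n::finite \<Rightarrow> complex^'m^'m) \<Rightarrow> ('n \<Rightarrow> real) \<Rightarrow> real
    \<Rightarrow> ('n \<Rightarrow> real) \<Rightarrow> 'n \<Rightarrow> real" where
  "gain \<rho> s lam p x = Re (trace (\<rho> x ** mat_ln (\<rho> x)))
     - Re (trace (\<rho> x ** mat_ln (mix \<rho> p))) - lam * s x"

definition BA_norm :: "('n::finite \<Rightarrow> complex^'m^'m) \<Rightarrow> ('n \<Rightarrow> real) \<Rightarrow> real \<Rightarrow> nat \<Rightarrow> real" where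
  "BA_norm \<rho> s lam t =
     (\<Sum>x\<in>UNIV. BA \<rho> s lam t x * exp (gain \<rho> s lam (BA \<rho> s lam t) x))"

lemma fobj_eq_gain:
  assumes "\<And>x. 0 \<le> p x" "\<And>x. p' x = 0 \<Longrightarrow> p x = 0"
  shows "fobj \<rho> s lam p p' =
    ereal ((\<Sum>x\<in>UNIV. p x * ln (p' x / p x)) + (\<Sum>x\<in>UNIV. p x * gain \<rho> s lam p' x))"
proof -
  have if_0: "(if p x = 0 then 0 else p x * w) = p x * w" for x and w :: real by simp
  have "\<not> (\<exists>x. p x > 0 \<and> p' x = 0)" using assms by force
  then show ?thesis
    by (simp add: fobj_def gain_def if_0 mat_mult_simps Re_trace_simps right_diff_distrib
        sum_subtractf sum_distrib_left mult_ac)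
qed

context
  fixes \<rho> :: "'n::finite \<Rightarrow> complex^'m^'m" and s :: "'n \<Rightarrow> real" and lam :: real
  assumes dens: "\<And>x. density_mat (\<rho> x)"
begin

text \<open>This is \<open>f(p, p') \<le> f(p, p)\<close>: the terms with
  \<open>mat_ln (\<rho> x)\<close> and \<open>s x\<close> cancel, leaving the data processing
  inequality.\<close>

lemma gain_data_processing:
  assumes "p \<in> prob_simplex" "p' \<in> prob_simplex" "\<And>x. p' x = 0 \<Longrightarrow> p x = 0"
  shows "(\<Sum>x\<in>UNIV. p x * ln (p' x / p x)) + (\<Sum>x\<in>UNIV. p x * gain \<rho> s lam p' x)
     \<le> (\<Sum>x\<in>UNIV. p x * gain \<rho> s lam p x)"
  using relative_entropy_mix_le[of \<rho>, OF dens assms]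
  by (simp add: gain_def Re_trace_mix right_diff_distrib sum_subtractf)

text \<open>Only the logarithms of the two mixtures survive the comparison, and Klein's inequality
  orders them.\<close>

lemma gain_klein:
  assumes "p \<in> prob_simplex" "p' \<in> prob_simplex" "\<And>x. p' x = 0 \<Longrightarrow> p x = 0"
  shows "(\<Sum>x\<in>UNIV. p x * gain \<rho> s lam p x) \<le> (\<Sum>x\<in>UNIV. p x * gain \<rho> s lam p' x)"
proof -
  have psd: "\<And>x. psd_mat (\<rho> x)" and tr: "\<And>x. Re (trace (\<rho> x)) = 1"
    using dens by (auto simp: density_mat_def)
  have nn: "\<And>x. 0 \<le> p x" "\<And>x. 0 \<le> p' x" and sums: "sum p UNIV = 1" "sum p' UNIV = 1"
    using assms by (auto simp: prob_simplex_def)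
  have "Re (trace (mix \<rho> p ** mat_ln (mix \<rho> p'))) \<le> Re (trace (mix \<rho> p ** mat_ln (mix \<rho> p)))"
  proof (rule klein_inequality)
    fix v assume "qform (mix \<rho> p') v = 0"
    then have "p x * qform (\<rho> x) v = 0" for x
      using qform_mix_eq_0[of \<rho> p', OF psd nn(2)] assms(3) by auto
    then show "qform (mix \<rho> p) v = 0" by (simp only: qform_mix sum.neutral_const)
  qed (use psd nn in \<open>auto intro: psd_mix simp: Re_trace_mix_left tr sums\<close>)
  then show ?thesis
    by (simp add: gain_def Re_trace_mix right_diff_distrib sum_subtractf)
qed

section \<open>The iterates and their normalising constants\<close>

text \<open>Positivity turns \<open>exp (ln p)\<close> into \<open>p\<close>, so the update is a
  multiplicative reweighting. It is a hypothesis here because the induction for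
  \<open>BA_pos\<close> uses this form.\<close>

lemma BA_Suc_of_pos:
  assumes "\<And>x. BA \<rho> s lam t x > 0"
  shows "BA \<rho> s lam (Suc t) x =
    BA \<rho> s lam t x * exp (gain \<rho> s lam (BA \<rho> s lam t) x) / BA_norm \<rho> s lam t"
proof -
  have "exp (ln (BA \<rho> s lam t x) + Re (trace (\<rho> x ** mat_ln (\<rho> x)))
        - Re (trace (\<rho> x ** mat_ln (mix \<rho> (BA \<rho> s lam t)))) - lam * s x)
      = BA \<rho> s lam t x * exp (gain \<rho> s lam (BA \<rho> s lam t) x)" for x
    using assms[of x] by (simp add: gain_def exp_add exp_diff)
  then show ?thesis by (simp add: Let_def BA_norm_def)
qed

lemma BA_pos: "BA \<rho> s lam t x > 0"
proof (induction t arbitrary: x)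
  case (Suc t)
  have "BA_norm \<rho> s lam t > 0"
    unfolding BA_norm_def by (intro sum_pos mult_pos_pos) (auto intro: Suc)
  then show ?case unfolding BA_Suc_of_pos[OF Suc] using Suc by simp
qed simp

lemma BA_norm_pos: "BA_norm \<rho> s lam t > 0"
  unfolding BA_norm_def by (intro sum_pos mult_pos_pos) (auto intro: BA_pos)

lemmas BA_Suc_eq = BA_Suc_of_pos[OF BA_pos]

lemma BA_simplex: "BA \<rho> s lam t \<in> prob_simplex"
proof -
  have "(\<Sum>x\<in>UNIV. BA \<rho> s lam t x) = 1"
  proof (cases t)
    case (Suc u)
    show ?thesis
      unfolding Suc BA_Suc_eq sum_divide_distrib[symmetric]
      using BA_norm_pos[of u] by (simp add: BA_norm_def)
  qed simp
  then show ?thesis by (simp add: prob_simplex_def BA_pos less_imp_le)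
qed

lemma ln_BA_ratio:
  "ln (BA \<rho> s lam (Suc t) x) - ln (BA \<rho> s lam t x) =
     gain \<rho> s lam (BA \<rho> s lam t) x - ln (BA_norm \<rho> s lam t)"
  unfolding BA_Suc_eq using BA_pos[of t x] BA_norm_pos[of t] by (simp add: ln_div ln_mult)

text \<open>Logarithmic ratio and gain add up to the same constant for every \<open>x\<close>, so
  averaging returns that constant.\<close>

lemma BA_step_value:
  "(\<Sum>x\<in>UNIV. BA \<rho> s lam (Suc t) x * ln (BA \<rho> s lam t x / BA \<rho> s lam (Suc t) x))
     + (\<Sum>x\<in>UNIV. BA \<rho> s lam (Suc t) x * gain \<rho> s lam (BA \<rho> s lam t) x) = ln (BA_norm \<rho> s lam t)"
proof -
  have "ln (BA \<rho> s lam t x / BA \<rho> s lam (Suc t) x) + gain \<rho> s lam (BA \<rho> s lam t) x = ln (BA_norm \<rho> s lam t)"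
    for x
    using ln_BA_ratio[of t x] BA_pos[of t x] BA_pos[of "Suc t" x] by (simp add: ln_div del: BA.simps)
  then have "(\<Sum>x\<in>UNIV. BA \<rho> s lam (Suc t) x * (ln (BA \<rho> s lam t x / BA \<rho> s lam (Suc t) x)
      + gain \<rho> s lam (BA \<rho> s lam t) x)) = (\<Sum>x\<in>UNIV. BA \<rho> s lam (Suc t) x) * ln (BA_norm \<rho> s lam t)"
    by (simp add: sum_distrib_right del: BA.simps)
  then show ?thesis
    using BA_simplex[of "Suc t"] by (simp add: prob_simplex_def distrib_left sum.distrib del: BA.simps)
qed

lemma BA_nonzero: "BA \<rho> s lam t x \<noteq> 0"
  using BA_pos[of t x] by simp

lemma fobj_BA: "fobj \<rho> s lam (BA \<rho> s lam (Suc t)) (BA \<rho> s lam t) = ereal (ln (BA_norm \<rho> s lam t))"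
  unfolding BA_step_value[symmetric] by (intro fobj_eq_gain) (auto simp: BA_pos less_imp_le BA_nonzero simp del: BA.simps)

text \<open>Alternating maximisation: moving the second argument to the new iterate raises the value
  by data processing, and optimising the first argument raises it again by Gibbs.\<close>

lemma ln_BA_norm_mono: "ln (BA_norm \<rho> s lam t) \<le> ln (BA_norm \<rho> s lam (Suc t))"
proof -
  let ?q = "BA \<rho> s lam (Suc t)"
  have "ln (BA_norm \<rho> s lam t) \<le> (\<Sum>x\<in>UNIV. ?q x * gain \<rho> s lam ?q x)"
    unfolding BA_step_value[symmetric]
    by (intro gain_data_processing BA_simplex) (simp add: BA_nonzero del: BA.simps)
  also have "\<dots> = (\<Sum>x\<in>UNIV. ?q x * ln (?q x * exp (gain \<rho> s lam ?q x) / ?q x))"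
    by (simp add: BA_nonzero del: BA.simps)
  also have "\<dots> \<le> ln (BA_norm \<rho> s lam (Suc t))"
    unfolding BA_norm_def
    by (intro gibbs_inequality BA_simplex) (simp add: BA_pos del: BA.simps)
  finally show ?thesis .
qed

text \<open>Here \<open>p\<close> is an arbitrary competitor, so the bound passes to the supremum in
  \<open>Fopt\<close>. The steps \<open>0\<close> to \<open>t\<close> number \<open>t + 1\<close>,
  whence the denominator.\<close>

lemma BA_gap:
  assumes p: "p \<in> prob_simplex"
  shows "(\<Sum>x\<in>UNIV. p x * gain \<rho> s lam p x)
    \<le> ln (BA_norm \<rho> s lam t) + ln (real CARD('n)) / real (Suc t)"
proof -
  define v where "v = (\<Sum>x\<in>UNIV. p x * gain \<rho> s lam p x)"
  define D where "D = (\<lambda>t. \<Sum>x\<in>UNIV. p x * ln (BA \<rho> s lam t x))"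
  have pn: "\<And>x. 0 \<le> p x" "sum p UNIV = 1" using p by (auto simp: prob_simplex_def)
  have step: "v - ln (BA_norm \<rho> s lam u) \<le> D (Suc u) - D u" for u
  proof -
    have "v \<le> (\<Sum>x\<in>UNIV. p x * gain \<rho> s lam (BA \<rho> s lam u) x)"
      unfolding v_def by (intro gain_klein p BA_simplex) (simp add: BA_nonzero)
    also have "\<dots> = (\<Sum>x\<in>UNIV. p x * (ln (BA_norm \<rho> s lam u)
        + (ln (BA \<rho> s lam (Suc u) x) - ln (BA \<rho> s lam u x))))"
      by (simp only: ln_BA_ratio) simp
    also have "\<dots> = ln (BA_norm \<rho> s lam u) + (D (Suc u) - D u)"
      by (simp add: D_def distrib_left right_diff_distrib sum.distrib sum_subtractf pn
          flip: sum_distrib_right del: BA.simps)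
    finally show ?thesis by simp
  qed
  \<comment> \<open>By monotonicity the gap at step \<open>t\<close> is the smallest so far, so it
    may replace each earlier one before telescoping.\<close>
  have "real (Suc t) * (v - ln (BA_norm \<rho> s lam t)) = (\<Sum>u<Suc t. v - ln (BA_norm \<rho> s lam t))" by simp
  also have "\<dots> \<le> (\<Sum>u<Suc t. D (Suc u) - D u)"
  proof (intro sum_mono)
    fix u assume "u \<in> {..<Suc t}"
    then have "ln (BA_norm \<rho> s lam u) \<le> ln (BA_norm \<rho> s lam t)"
      by (intro lift_Suc_mono_le[of "\<lambda>t. ln (BA_norm \<rho> s lam t)", OF ln_BA_norm_mono]) auto
    with step[of u] show "v - ln (BA_norm \<rho> s lam t) \<le> D (Suc u) - D u" by simp
  qed
  also have "\<dots> = D (Suc t) - D 0" by (rule sum_lessThan_telescope)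
  also have "\<dots> \<le> ln (real CARD('n))"
  proof -
    \<comment> \<open>The telescoped potential ends at most at zero since all entries are at most 1,
      and it starts at \<open>- ln n\<close> since the initial distribution is uniform.\<close>
    have "BA \<rho> s lam (Suc t) x \<le> 1" for x
      using BA_simplex[of "Suc t"] member_le_sum[of x UNIV "BA \<rho> s lam (Suc t)"]
      by (simp add: prob_simplex_def del: BA.simps)
    then have "D (Suc t) \<le> 0"
      unfolding D_def by (intro sum_nonpos mult_nonneg_nonpos pn) (simp add: ln_le_zero_iff BA_pos del: BA.simps)
    moreover have "D 0 = - ln (real CARD('n))"
      by (simp add: D_def ln_div sum_negf pn flip: sum_distrib_right)
    ultimately show ?thesis by simp
  qed
  finally show ?thesis by (simp add: v_def field_simps del: of_nat_Suc)
qed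

text \<open>The iterates compete in the supremum, which gives the lower bounds; data processing and
  \<open>BA_gap\<close> give the upper ones. Lying between two reals, \<open>Fopt\<close> is
  finite.\<close>

lemma Fopt_bounds:
  obtains F where "Fopt \<rho> s lam = ereal F"
    "\<And>t. ln (BA_norm \<rho> s lam t) \<le> F"
    "\<And>t. F \<le> ln (BA_norm \<rho> s lam t) + ln (real CARD('n)) / real (Suc t)"
proof -
  have lower: "ereal (ln (BA_norm \<rho> s lam t)) \<le> Fopt \<rho> s lam" for t
    unfolding fobj_BA[symmetric] Fopt_def
    by (rule SUP_upper2[OF BA_simplex], rule SUP_upper[OF BA_simplex])
  have upper: "Fopt \<rho> s lam \<le> ereal (ln (BA_norm \<rho> s lam t) + ln (real CARD('n)) / real (Suc t))" for t
    unfolding Fopt_def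
  proof (intro SUP_least)
    fix p p' :: "'n \<Rightarrow> real" assume p: "p \<in> prob_simplex" and p': "p' \<in> prob_simplex"
    show "fobj \<rho> s lam p p' \<le> ereal (ln (BA_norm \<rho> s lam t) + ln (real CARD('n)) / real (Suc t))"
    proof (cases "\<exists>x. p x > 0 \<and> p' x = 0")
      case False
      have nn: "0 \<le> p x" for x using p by (simp add: prob_simplex_def)
      have ac: "p x = 0" if "p' x = 0" for x using False nn[of x] that by (auto simp: less_le)
      have "fobj \<rho> s lam p p' \<le> ereal (\<Sum>x\<in>UNIV. p x * gain \<rho> s lam p x)"
        using fobj_eq_gain[of p p' \<rho> s lam] gain_data_processing[OF p p'] nn ac by auto
      also have "\<dots> \<le> ereal (ln (BA_norm \<rho> s lam t) + ln (real CARD('n)) / real (Suc t))"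
        unfolding ereal_less_eq by (rule BA_gap[OF p])
      finally show ?thesis .
    qed (simp add: fobj_def)
  qed
  have "\<bar>Fopt \<rho> s lam\<bar> \<noteq> \<infinity>" using lower[of 0] upper[of 0] by auto
  then obtain F where "Fopt \<rho> s lam = ereal F" by auto
  with lower upper that show ?thesis by (metis ereal_less_eq(3))
qed

end

theorem theorem4:
  fixes \<rho> :: "'n::finite \<Rightarrow> complex^'m^'m" and s :: "'n \<Rightarrow> real" and lam :: real
  assumes "CARD('n) \<ge> 2"
    and "\<And>x. density_mat (\<rho> x)"
    and "\<And>x. s x \<ge> 0"
    and "lam \<ge> 0"
  shows "(\<forall>t::nat. t \<ge> 1 \<longrightarrow>
            0 \<le> Fopt \<rho> s lam - fobj \<rho> s lam (BA \<rho> s lam (Suc t)) (BA \<rho> s lam t) \<and>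
            Fopt \<rho> s lam - fobj \<rho> s lam (BA \<rho> s lam (Suc t)) (BA \<rho> s lam t)
              < ereal (ln (real CARD('n)) / real t))
       \<and> (\<forall>\<epsilon>>0. \<forall>t::nat. t \<ge> 1 \<longrightarrow> real t \<ge> ln (real CARD('n)) / \<epsilon> \<longrightarrow>
            Fopt \<rho> s lam - fobj \<rho> s lam (BA \<rho> s lam (Suc t)) (BA \<rho> s lam t) < ereal \<epsilon>)"
proof -
  obtain F where F: "Fopt \<rho> s lam = ereal F"
    "\<And>t. ln (BA_norm \<rho> s lam t) \<le> F"
    "\<And>t. F \<le> ln (BA_norm \<rho> s lam t) + ln (real CARD('n)) / real (Suc t)"
    by (rule Fopt_bounds[of \<rho> s lam, OF assms(2)]) (rule that)
  have diff: "Fopt \<rho> s lam - fobj \<rho> s lam (BA \<rho> s lam (Suc t)) (BA \<rho> s lam t)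
      = ereal (F - ln (BA_norm \<rho> s lam t))" for t
    by (simp add: F(1) fobj_BA[of \<rho> s lam, OF assms(2)] del: BA.simps)
  \<comment> \<open>Strictness comes from the denominator \<open>t + 1\<close> in place of
    \<open>t\<close>, and from \<open>ln n > 0\<close> for \<open>n \<ge> 2\<close>.\<close>
  have "ln (real CARD('n)) > 0" using assms(1) by simp
  then have "ln (real CARD('n)) / real (Suc t) < ln (real CARD('n)) / real t" if "t \<ge> 1" for t
    using that by (intro divide_strict_left_mono) auto
  then have strict: "F - ln (BA_norm \<rho> s lam t) < ln (real CARD('n)) / real t" if "t \<ge> 1" for t
    using F(3)[of t] that by force
  have "F - ln (BA_norm \<rho> s lam t) < \<epsilon>"
    if "\<epsilon> > 0" "t \<ge> 1" "real t \<ge> ln (real CARD('n)) / \<epsilon>" for \<epsilon> t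
  proof -
    have "ln (real CARD('n)) / real t \<le> \<epsilon>"
      using that by (simp add: field_simps)
    with strict[OF that(2)] show ?thesis by simp
  qed
  with strict F(2) show ?thesis by (simp add: diff del: BA.simps)
qed

end
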